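(* Let $W=W(t)\,dt$ be an $N\times N$ signed weight matrix with smooth density $W(t)$ on $(a,b)$, invertible in the closure of the interval $(a,b)$. Let $D(y)=y''F_2+y'F_1+yF_0$ be a second order differential operator with $F_0,F_1,F_2\in\mathcal R_{a,b}$, with $F_2$ invertible on $(a,b)$, satisfying on $(a,b)$ $$F_2W=WF_2^*,\qquad 2(F_2W)'=WF_1^*+F_1W,$$ and $\lim_{x\to a,b}p\,(F_2W)^*=0$ for every $p\in\mathcal R_{a,b}$. Let $X\subset\mathbb N$ be finite and assume that there are matrix polynomials $P_n$, $n\in\mathbb N\setminus X$, of degree $n$ with nonsingular leading coefficient, orthogonal with respect to $W$ and eigenfunctions of $D$: $D(P_n)=\Gamma_nP_n$ with constant matrices $\Gamma_n$. Let $P$ be a matrix function in the kernel of $D$ (i.e. $D(P)=0$), invertible on the closure of $(a,b)$, satisfying $$(\tfrac12F_1+P^{-1}P'F_2)W=W(\tfrac12F_1+P^{-1}P'F_2)^*,$$ and for which there exists a matrix polynomial $U$ such that $A_1:=(P')^{-1}PU$ is a matrix polynomial without zeros in the closure of $(a,b)$ (i.e. $\det A_1(t)\ne0$ there). Put $A_0=-U$ and define the first order operators $$\mathcal A(y)=yA_0+y'A_1,\qquad \mathcal B(y)=yB_0+y'B_1,\quad B_1=A_1^{-1}F_2,\quad B_0=A_1^{-1}(F_1-A_0B_1-A_1'B_1).$$ Then $$\mathcal A=\partial (P')^{-1}PU-U,\qquad \mathcal B=-(\partial-P^{-1}P')^\dagger\circ(U^{-1}P^{-1}P'F_2),$$ and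 the operator $\mathcal D=\mathcal A\circ\mathcal B$ is symmetric with respect to the pair $(\mathcal W,\mathbb A)$, where $$\mathcal W=(U^{-1}P^{-1}P')\,F_2W\,(U^{-1}P^{-1}P')^*$$ and $\mathbb A$ is the linear subspace of matrix polynomials generated (with left matrix coefficients) by the polynomials $\mathcal P_n=\mathcal A(P_n)$, $n\in\mathbb N\setminus X$. Moreover, the polynomials $\mathcal P_n$, $n\in\mathbb N\setminus X$, are orthogonal with respect to $\mathcal W$ and eigenfunctions of $\mathcal D$: $\mathcal D(\mathcal P_n)=\Gamma_n\mathcal P_n$.
   Context: All matrices are $N\times N$ with real entries; $*$ denotes (conjugate) transpose; $\mathbb N=\{0,1,2,\dots\}$. $(a,b)$ is a bounded or unbounded interval. A signed weight matrix $W(t)dt$ on $(a,b)$: $W(t)$ is a Hermitian matrix function all of whose moments $\int_a^b t^nW(t)\,dt$ are finite (no positivity required). $\mathcal R_{a,b}$ is the space of matrix-valued rational functions with no poles in the closure of $(a,b)$. For a matrix density $V$, $\langle p,q\rangle_V=\int_a^b p(t)V(t)q^*(t)\,dt$. Differential operators act with coefficients on the right: $E=\sum_j\partial^jE_j$ means $E(y)=\sum_j y^{(j)}E_j$; a matrix function $G$ regarded as an operator is $y\mapsto yG$; $(E\circ T)(y)=E(T(y))$. The formal adjoint with respect to $W$ is $E^\dagger(y)=\big(\sum_j(-1)^j(yWE_j^* )^{(j)}\big)W^{-1}$. The polynomials $P_n$ being orthogonal with respect to $W$ means $\langle P_n,P_m\rangle_W=0$ for $n\neq m$ with $\langle P_n,P_n\rangle_W$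 nonsingular. For the functions $\mathcal P_n$, orthogonality with respect to $\mathcal W$ means $\langle\mathcal P_n,\mathcal P_m\rangle_{\mathcal W}=0$ for $n\ne m$. The function $P$ is smooth on the closure of $(a,b)$. The expression $(P')^{-1}PU$ is understood where $P'$ is invertible (all but finitely many points) and is assumed to coincide there with a polynomial $A_1$; the expression $U^{-1}P^{-1}P'$ denotes the rational function $A_1^{-1}$. An operator $\mathcal D$ mapping $\mathbb A$ into matrix polynomials is symmetric with respect to the pair $(\mathcal W,\mathbb A)$ if $\langle\mathcal D(p),q\rangle_{\mathcal W}=\langle p,\mathcal D(q)\rangle_{\mathcal W}$ for all $p,q\in\mathbb A$. The linear subspace generated by the $\mathcal P_n$ is the set of finite sums $\sum C_n\mathcal P_n$ with $C_n\in\mathbb R^{N\times N}$. *)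

theory Defs
  imports "HOL-Analysis.Analysis" "HOL-Computational_Algebra.Polynomial"
begin

type_synonym 'n matfun = "real \<Rightarrow> real^'n^'n"

text \<open>Polynomials with matrix coefficients: only coefficients, degree and leading coefficient of
  the \<open>poly\<close> type are used; its ring multiplication would be based on the entrywise product.\<close>

definition mat_poly_eval :: "(real^'n^'n) poly \<Rightarrow> 'n::finite matfun" where
  "mat_poly_eval p t = (\<Sum>k\<le>degree p. t ^ k *\<^sub>R coeff p k)"

definition matrix_polynomial :: "'n::finite matfun \<Rightarrow> bool" where
  "matrix_polynomial f \<longleftrightarrow> (\<exists>p. f = mat_poly_eval p)"

definition matrix_polynomial_regular :: "nat \<Rightarrow> 'n::finite matfun \<Rightarrow> bool" where
  "matrix_polynomial_regular n f \<longleftrightarrow>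
     (\<exists>p. degree p = n \<and> invertible (lead_coeff p) \<and> f = mat_poly_eval p)"

text \<open>Rational matrix functions without poles in \<open>S\<close>; only the values on \<open>S\<close> matter. The space
  \<open>R\<close> attached to the interval \<open>(a, b)\<close> is obtained for \<open>S = closure (einterval a b)\<close>, the closure
  being taken in the real line, so that infinite endpoints are not included.\<close>

definition matrix_rational_on :: "real set \<Rightarrow> 'n::finite matfun \<Rightarrow> bool" where
  "matrix_rational_on S F \<longleftrightarrow>
     (\<forall>i j. \<exists>p q :: real poly. \<forall>t\<in>S. poly q t \<noteq> 0 \<and> F t $ i $ j = poly p t / poly q t)"

text \<open>At an endpoint belonging to \<open>S\<close> the derivatives are one-sided.\<close>

definition smooth_on :: "real set \<Rightarrow> 'n::finite matfun \<Rightarrow> bool" where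
  "smooth_on S f \<longleftrightarrow>
     (\<exists>d :: nat \<Rightarrow> 'n matfun. (\<forall>t\<in>S. d 0 t = f t) \<and>
        (\<forall>k. \<forall>t\<in>S. (d k has_vector_derivative d (Suc k) t) (at t within S)))"

definition mderiv :: "'n::finite matfun \<Rightarrow> 'n matfun" where
  "mderiv f t = vector_derivative f (at t)"

text \<open>Differential operators have coefficients on the right; the \<open>j\<close>-th entry of the list \<open>Es\<close> is the
  coefficient of the \<open>j\<close>-th derivative. In particular, \<open>diffop [G]\<close> is \<open>G\<close> regarded as an operator.\<close>

definition diffop :: "'n::finite matfun list \<Rightarrow> 'n matfun \<Rightarrow> 'n matfun" where
  "diffop Es y t = (\<Sum>j<length Es. (mderiv ^^ j) y t ** (Es ! j) t)"

definition formal_adjoint ::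
    "'n::finite matfun \<Rightarrow> 'n matfun list \<Rightarrow> 'n matfun \<Rightarrow> 'n matfun" where
  "formal_adjoint W Es y t =
     (\<Sum>j<length Es. (-1) ^ j *\<^sub>R (mderiv ^^ j) (\<lambda>s. y s ** W s ** transpose ((Es ! j) s)) t)
       ** matrix_inv (W t)"

definition signed_weight :: "real set \<Rightarrow> 'n::finite matfun \<Rightarrow> bool" where
  "signed_weight I W \<longleftrightarrow>
     (\<forall>t\<in>I. transpose (W t) = W t) \<and> (\<forall>n::nat. set_integrable lborel I (\<lambda>t. t ^ n *\<^sub>R W t))"

definition mat_ip :: "real set \<Rightarrow> 'n::finite matfun \<Rightarrow> 'n matfun \<Rightarrow> 'n matfun \<Rightarrow> real^'n^'n" where
  "mat_ip I V p q = set_lebesgue_integral lborel I (\<lambda>t. p t ** V t ** transpose (q t))"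

text \<open>The Lebesgue integral of a non-integrable function is \<open>0\<close> by convention, so convergence is
  recorded separately.\<close>

definition mat_ip_exists :: "real set \<Rightarrow> 'n::finite matfun \<Rightarrow> 'n matfun \<Rightarrow> 'n::finite matfun \<Rightarrow> bool" where
  "mat_ip_exists I V p q \<longleftrightarrow> set_integrable lborel I (\<lambda>t. p t ** V t ** transpose (q t))"

definition orthogonal_family ::
    "real set \<Rightarrow> 'n::finite matfun \<Rightarrow> nat set \<Rightarrow> (nat \<Rightarrow> 'n matfun) \<Rightarrow> bool" where
  "orthogonal_family I V J p \<longleftrightarrow>
     (\<forall>n\<in>J. \<forall>m\<in>J. mat_ip_exists I V (p n) (p m) \<and> (n \<noteq> m \<longrightarrow> mat_ip I V (p n) (p m) = 0))"

definition left_span :: "nat set \<Rightarrow> (nat \<Rightarrow> 'n::finite matfun) \<Rightarrow> 'n matfun set" where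
  "left_span J p = {\<lambda>t. \<Sum>n\<in>K. C n ** p n t | K C. finite K \<and> K \<subseteq> J}"

definition symmetric_wrt_pair ::
    "real set \<Rightarrow> 'n::finite matfun \<Rightarrow> 'n matfun set \<Rightarrow> ('n matfun \<Rightarrow> 'n matfun) \<Rightarrow> bool" where
  "symmetric_wrt_pair I V AA T \<longleftrightarrow>
     (\<forall>p\<in>AA. \<exists>r. matrix_polynomial r \<and> (\<forall>t\<in>I. T p t = r t)) \<and>
     (\<forall>p\<in>AA. \<forall>q\<in>AA. mat_ip_exists I V (T p) q \<and> mat_ip_exists I V p (T q) \<and>
        mat_ip I V (T p) q = mat_ip I V p (T q))"

end

theory Submission
  imports Defs
begin

text \<open>The relation \<open>A1 = (P')\<inverse> P U\<close> says that \<open>Q = P\<inverse> P'\<close> is the rational function \<open>U A1\<inverse>\<close>, so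
  the first order operator is \<open>y \<mapsto> (y' - y Q) A1\<close>. It annihilates the invertible \<open>P\<close>, as does \<open>D\<close>, whence
  \<open>D = \<B> \<circ> \<A>\<close> and \<open>\<D> (\<A> P\<^sub>n) = \<A> (D P\<^sub>n)\<close>. Writing \<open>\<eta> = y' - y Q\<close> and \<open>V = F2 W\<close>, the symmetry
  equations give \<open>(\<eta> V w\<^sup>*)' = \<A>(y) \<W> \<A>(w)\<^sup>* + D(y) W w\<^sup>*\<close>, and the boundary terms vanish. Hence
  \<open>\<langle>\<A> y, \<A> w\<rangle>\<^sub>\<W> = - \<langle>D y, w\<rangle>\<^sub>W\<close>, from which orthogonality and symmetry follow. All the integrals
  converge because a rational function without poles in a closed set is bounded there by a
  polynomial.\<close>

section \<open>Matrix calculus\<close>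

text \<open>In finite dimension bilinearity already gives boundedness. The interpretation that
  follows supplies product rules, continuity and distribution over sums for the matrix
  product.\<close>

lemma bounded_bilinear_matrix_matrix_mult:
  "bounded_bilinear ((**) :: real^'n^'m \<Rightarrow> real^'p^'n \<Rightarrow> real^'p^'m)"
proof -
  have "bilinear ((**) :: real^'n^'m \<Rightarrow> real^'p^'n \<Rightarrow> real^'p^'m)"
    unfolding bilinear_def
    by (auto intro!: linearI simp: matrix_matrix_mult_def vec_eq_iff algebra_simps sum.distrib
        sum_distrib_left)
  then show ?thesis
    by (simp add: bilinear_conv_bounded_bilinear)
qed

interpretation matrix_mult: bounded_bilinear "(**) :: real^'n^'m \<Rightarrow> real^'p^'n \<Rightarrow> real^'p^'m"
  by (rule bounded_bilinear_matrix_matrix_mult)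

lemma bounded_linear_transpose: "bounded_linear (transpose :: real^'n^'m \<Rightarrow> real^'m^'n)"
  by (auto intro!: linearI simp: linear_conv_bounded_linear[symmetric] transpose_def vec_eq_iff)

lemmas matrix_ring_simps =
  matrix_mult.add_left matrix_mult.add_right matrix_mult.diff_left matrix_mult.diff_right
  matrix_mult.minus_left matrix_mult.minus_right matrix_mult.scaleR_left matrix_mult.scaleR_right
  matrix_mul_assoc

lemmas transpose_simps =
  linear_simps[OF bounded_linear_transpose] matrix_transpose_mul transpose_transpose

text \<open>\<open>matrix_inv\<close> is a choice, so its two defining equations come from
  \<open>someI_ex\<close>. The remaining forms cancel inside products of either bracketing.\<close>

lemma matrix_inv_cancel:
  fixes A :: "real^'n^'n"
  assumes "invertible A"
  shows "A ** matrix_inv A = mat 1" "matrix_inv A ** A = mat 1"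
    "B ** A ** matrix_inv A = B" "B ** matrix_inv A ** A = B"
    "A ** (matrix_inv A ** C) = C" "matrix_inv A ** (A ** C) = C"
proof -
  have "A ** matrix_inv A = mat 1 \<and> matrix_inv A ** A = mat 1"
    using assms unfolding invertible_def matrix_inv_def by (rule someI_ex)
  then show *: "A ** matrix_inv A = mat 1" "matrix_inv A ** A = mat 1"
    by auto
  show "B ** A ** matrix_inv A = B" "B ** matrix_inv A ** A = B"
    by (simp_all add: matrix_mul_assoc[symmetric] *)
  show "A ** (matrix_inv A ** C) = C" "matrix_inv A ** (A ** C) = C"
    by (simp_all add: matrix_mul_assoc *)
qed

lemma matrix_inv_unique_left:
  fixes A B :: "real^'n^'n"
  assumes "B ** A = mat 1"
  shows "matrix_inv A = B"
proof -
  have "invertible A"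
    using assms by (auto simp: invertible_left_inverse)
  then have "B ** (A ** matrix_inv A) = B"
    by (simp add: matrix_inv_cancel)
  then show ?thesis
    by (simp add: matrix_mul_assoc assms)
qed

text \<open>Cramer's rule for the columns of the identity. It exhibits the entries of the inverse as
  quotients of determinants, hence as rational functions when those of \<open>A\<close> are.\<close>

lemma matrix_inv_entry:
  fixes A :: "real^'n^'n"
  assumes "det A \<noteq> 0"
  shows "matrix_inv A $ i $ j =
    det (\<chi> r c. if c = i then axis j 1 $ r else A $ r $ c) / det A"
proof -
  have "A ** matrix_inv A = mat 1"
    using assms by (simp add: invertible_det_nz matrix_inv_cancel)
  then have "A *v column j (matrix_inv A) = column j (mat 1)"
    by (simp add: vec_eq_iff matrix_vector_mult_def column_def matrix_matrix_mult_def)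
  also have "column j (mat 1) = (axis j 1 :: real^'n)"
    by (auto simp: column_def mat_def axis_def vec_eq_iff)
  finally have "column j (matrix_inv A) =
      (\<chi> k. det (\<chi> r c. if c = k then axis j 1 $ r else A $ r $ c) / det A)"
    using cramer[OF assms] by blast
  then have "column j (matrix_inv A) $ i =
      det (\<chi> r c. if c = i then axis j 1 $ r else A $ r $ c) / det A"
    by simp
  then show ?thesis
    by (simp add: column_def)
qed

text \<open>Expansion in matrix units, which reduces differentiation and integration of matrix
  functions to scalar coefficients.\<close>

lemma matrix_entry_expansion:
  fixes M :: "real^'n^'m"
  shows "M = (\<Sum>i\<in>UNIV. \<Sum>j\<in>UNIV. (M $ i $ j) *\<^sub>R axis i (axis j 1))"
proof -
  have "(\<Sum>i\<in>UNIV. \<Sum>j\<in>UNIV. (M $ i $ j) *\<^sub>R axis i (axis j 1)) $ r $ c = M $ r $ c" for r c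
  proof -
    have "(\<Sum>i\<in>UNIV. \<Sum>j\<in>UNIV. (M $ i $ j) *\<^sub>R axis i (axis j (1::real))) $ r $ c =
        (\<Sum>i\<in>UNIV. \<Sum>j\<in>UNIV. if i = r then if j = c then M $ i $ j else 0 else 0)"
      unfolding sum_component by (intro sum.cong) (auto simp: axis_def)
    also have "\<dots> = (\<Sum>i\<in>UNIV. if i = r then M $ i $ c else 0)"
      by (intro sum.cong) auto
    finally show ?thesis by simp
  qed
  then show ?thesis
    by (simp add: vec_eq_iff)
qed

lemma has_vector_derivative_matrixI:
  fixes f :: "real \<Rightarrow> real^'n^'m"
  assumes "\<And>i j. ((\<lambda>t. f t $ i $ j) has_real_derivative f' $ i $ j) (at t)"
  shows "(f has_vector_derivative f') (at t)"
proof -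
  have "((\<lambda>t. \<Sum>i\<in>UNIV. \<Sum>j\<in>UNIV. (f t $ i $ j) *\<^sub>R axis i (axis j 1)) has_vector_derivative
     (\<Sum>i\<in>UNIV. \<Sum>j\<in>UNIV. (f' $ i $ j) *\<^sub>R (axis i (axis j 1) :: real^'n^'m))) (at t)"
    using assms
    by (auto intro!: derivative_eq_intros simp: fun_eq_iff)
  then show ?thesis
    by (simp flip: matrix_entry_expansion)
qed

lemma mderiv_eqI: "(f has_vector_derivative f') (at t) \<Longrightarrow> mderiv f t = f'"
  unfolding mderiv_def by (rule vector_derivative_at)

text \<open>Both functions have the same candidates for a derivative at \<open>t\<close>, so the
  choice behind \<open>vector_derivative\<close> returns the same value, also where no derivative
  exists.\<close>

lemma mderiv_eq_on_open:
  assumes "open T" "t \<in> T" "\<And>s. s \<in> T \<Longrightarrow> f s = g s"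
  shows "mderiv f t = mderiv g t"
proof -
  have "(f has_vector_derivative v) (at t) \<longleftrightarrow> (g has_vector_derivative v) (at t)" for v
    using assms by (metis has_vector_derivative_transform_within_open)
  then show ?thesis
    by (simp add: mderiv_def vector_derivative_def)
qed

lemma smooth_on_subset: "smooth_on T f \<Longrightarrow> T' \<subseteq> T \<Longrightarrow> smooth_on T' f"
  unfolding smooth_on_def by (blast intro: has_vector_derivative_within_subset)

text \<open>On an open set derivatives within \<open>T\<close> are ordinary ones, so
  \<open>d 1\<close> is \<open>mderiv f\<close> there; the witnessing sequence shifted by one shows
  that \<open>mderiv f\<close> is smooth again.\<close>

lemma smooth_on_openE:
  assumes "smooth_on T f" "open T"
  shows "t \<in> T \<Longrightarrow> (f has_vector_derivative mderiv f t) (at t)"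
    and "smooth_on T (mderiv f)"
proof -
  obtain d where d0: "\<And>t. t \<in> T \<Longrightarrow> d 0 t = f t"
    and d: "\<And>k t. t \<in> T \<Longrightarrow> (d k has_vector_derivative d (Suc k) t) (at t within T)"
    using assms(1) unfolding smooth_on_def by metis
  have "(d 0 has_vector_derivative d 1 t) (at t)" if "t \<in> T" for t
    using d[OF that, of 0] unfolding at_within_open[OF that assms(2)] by simp
  then have f: "(f has_vector_derivative d 1 t) (at t)" if "t \<in> T" for t
    using that assms(2) d0 by (metis has_vector_derivative_transform_within_open)
  then have m: "mderiv f t = d 1 t" if "t \<in> T" for t
    using that by (blast intro: mderiv_eqI)
  show "t \<in> T \<Longrightarrow> (f has_vector_derivative mderiv f t) (at t)"
    using f m by simp
  show "smooth_on T (mderiv f)"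
    unfolding smooth_on_def using d m by (intro exI[of _ "\<lambda>k. d (Suc k)"]) auto
qed

lemma diffop_order1: "diffop [E0, E1] y t = y t ** E0 t + mderiv y t ** E1 t"
  by (simp add: diffop_def lessThan_Suc eval_nat_numeral)

lemma diffop_order2:
  "diffop [E0, E1, E2] y t = y t ** E0 t + mderiv y t ** E1 t + mderiv (mderiv y) t ** E2 t"
  by (simp add: diffop_def lessThan_Suc eval_nat_numeral)

section \<open>Rational matrix functions\<close>

definition rational_on :: "real set \<Rightarrow> (real \<Rightarrow> real) \<Rightarrow> bool" where
  "rational_on T f \<longleftrightarrow> (\<exists>p q. \<forall>t\<in>T. poly q t \<noteq> 0 \<and> f t = poly p t / poly q t)"

lemma matrix_rational_on_entries:
  "matrix_rational_on T F \<longleftrightarrow> (\<forall>i j. rational_on T (\<lambda>t. F t $ i $ j))"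
  by (simp add: matrix_rational_on_def rational_on_def)

lemma rational_on_poly: "rational_on T (poly p)"
  unfolding rational_on_def by (intro exI[of _ p] exI[of _ 1]) simp

lemma rational_on_const: "rational_on T (\<lambda>t. c)"
  unfolding rational_on_def by (intro exI[of _ "[:c:]"] exI[of _ 1]) simp

lemma rational_on_cong:
  "(\<And>t. t \<in> T \<Longrightarrow> f t = g t) \<Longrightarrow> rational_on T f \<longleftrightarrow> rational_on T g"
  by (simp add: rational_on_def)

lemma rational_on_add:
  assumes "rational_on T f" "rational_on T g"
  shows "rational_on T (\<lambda>t. f t + g t)"
proof -
  obtain p q r s where
    "\<And>t. t \<in> T \<Longrightarrow> poly q t \<noteq> 0 \<and> f t = poly p t / poly q t"
    "\<And>t. t \<in> T \<Longrightarrow> poly s t \<noteq> 0 \<and> g t = poly r t / poly s t"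
    using assms unfolding rational_on_def by metis
  then show ?thesis
    unfolding rational_on_def
    by (intro exI[of _ "p * s + r * q"] exI[of _ "q * s"]) (simp add: add_frac_eq)
qed

lemma rational_on_mult:
  assumes "rational_on T f" "rational_on T g"
  shows "rational_on T (\<lambda>t. f t * g t)"
proof -
  obtain p q r s where
    "\<And>t. t \<in> T \<Longrightarrow> poly q t \<noteq> 0 \<and> f t = poly p t / poly q t"
    "\<And>t. t \<in> T \<Longrightarrow> poly s t \<noteq> 0 \<and> g t = poly r t / poly s t"
    using assms unfolding rational_on_def by metis
  then show ?thesis
    unfolding rational_on_def
    by (intro exI[of _ "p * r"] exI[of _ "q * s"]) simp
qed

lemma rational_on_divide:
  assumes "rational_on T f" "rational_on T g" "\<And>t. t \<in> T \<Longrightarrow> g t \<noteq> 0"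
  shows "rational_on T (\<lambda>t. f t / g t)"
proof -
  obtain p q r s where
    "\<And>t. t \<in> T \<Longrightarrow> poly q t \<noteq> 0 \<and> f t = poly p t / poly q t"
    "\<And>t. t \<in> T \<Longrightarrow> poly s t \<noteq> 0 \<and> g t = poly r t / poly s t"
    using assms unfolding rational_on_def by metis
  with assms(3) show ?thesis
    unfolding rational_on_def
    by (intro exI[of _ "p * s"] exI[of _ "q * r"]) fastforce
qed

lemma rational_on_sum:
  "(\<And>i. i \<in> K \<Longrightarrow> rational_on T (f i)) \<Longrightarrow> rational_on T (\<lambda>t. \<Sum>i\<in>K. f i t)"
  by (induction K rule: infinite_finite_induct) (auto intro: rational_on_const rational_on_add)

lemma rational_on_prod:
  "(\<And>i. i \<in> K \<Longrightarrow> rational_on T (f i)) \<Longrightarrow> rational_on T (\<lambda>t. \<Prod>i\<in>K. f i t)"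
  by (induction K rule: infinite_finite_induct) (auto intro: rational_on_const rational_on_mult)

lemma rational_on_det:
  assumes "matrix_rational_on T F"
  shows "rational_on T (\<lambda>t. det (F t))"
  unfolding det_def using assms
  by (auto intro!: rational_on_sum rational_on_mult rational_on_prod rational_on_const
      simp: matrix_rational_on_entries)

lemma matrix_rational_on_add:
  "matrix_rational_on T F \<Longrightarrow> matrix_rational_on T G \<Longrightarrow> matrix_rational_on T (\<lambda>t. F t + G t)"
  by (simp add: matrix_rational_on_entries rational_on_add)

lemma matrix_rational_on_mult:
  "matrix_rational_on T F \<Longrightarrow> matrix_rational_on T G \<Longrightarrow> matrix_rational_on T (\<lambda>t. F t ** G t)"
  by (simp add: matrix_rational_on_entries matrix_matrix_mult_def rational_on_sum rational_on_mult)

lemma matrix_rational_on_scaleR: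
  "rational_on T c \<Longrightarrow> matrix_rational_on T F \<Longrightarrow> matrix_rational_on T (\<lambda>t. c t *\<^sub>R F t)"
  by (simp add: matrix_rational_on_entries rational_on_mult)

lemma matrix_rational_on_diff:
  assumes "matrix_rational_on T F" "matrix_rational_on T G"
  shows "matrix_rational_on T (\<lambda>t. F t - G t)"
  using matrix_rational_on_add[OF assms(1)
      matrix_rational_on_scaleR[OF rational_on_const[of T "-1"] assms(2)]] by simp

text \<open>By Cramer's rule each entry is a quotient of determinants of rational matrices, with
  denominator \<open>det (F t)\<close>, which has no zero on \<open>T\<close>.\<close>

lemma matrix_rational_on_inv:
  assumes "matrix_rational_on T F" "\<And>t. t \<in> T \<Longrightarrow> det (F t) \<noteq> 0"
  shows "matrix_rational_on T (\<lambda>t. matrix_inv (F t))"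
proof -
  have "rational_on T (\<lambda>t. matrix_inv (F t) $ i $ j)" for i j
  proof -
    \<comment> \<open>The replaced column is constant and the others are columns of
      \<open>F\<close>, hence the case distinction on the column index.\<close>
    have "matrix_rational_on T (\<lambda>t. \<chi> r c. if c = i then axis j 1 $ r else F t $ r $ c)"
      using assms(1) unfolding matrix_rational_on_entries
      by (intro allI, case_tac "ja = i") (simp_all add: rational_on_const)
    then have "rational_on T (\<lambda>t.
        det (\<chi> r c. if c = i then axis j 1 $ r else F t $ r $ c) / det (F t))"
      using assms by (intro rational_on_divide rational_on_det)
    then show ?thesis
      using assms(2) by (simp add: matrix_inv_entry cong: rational_on_cong)
  qed
  then show ?thesis
    by (simp add: matrix_rational_on_entries)
qed

text \<open>\<open>F\<close> is a quotient of polynomials on \<open>T\<close> only; the open set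
  \<open>I\<close> inside \<open>T\<close> transfers the derivative of the quotient to
  \<open>F\<close>.\<close>

lemma matrix_rational_on_differentiable:
  assumes "matrix_rational_on T F" "open I" "I \<subseteq> T" "t \<in> I"
  shows "(F has_vector_derivative mderiv F t) (at t)"
proof -
  have "\<exists>D. ((\<lambda>s. F s $ i $ j) has_real_derivative D) (at t)" for i j
  proof -
    obtain p q where pq: "\<And>s. s \<in> T \<Longrightarrow> poly q s \<noteq> 0 \<and> F s $ i $ j = poly p s / poly q s"
      using assms(1) unfolding matrix_rational_on_def by metis
    have "((\<lambda>s. poly p s / poly q s) has_real_derivative
        (poly (pderiv p) t * poly q t - poly p t * poly (pderiv q) t) / (poly q t * poly q t)) (at t)"
      using pq assms(3,4) by (intro DERIV_divide poly_DERIV) auto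
    then have "((\<lambda>s. F s $ i $ j) has_real_derivative
        (poly (pderiv p) t * poly q t - poly p t * poly (pderiv q) t) / (poly q t * poly q t)) (at t)"
      by (rule has_field_derivative_transform_within_open[OF _ assms(2,4)]) (use pq assms(3) in auto)
    then show ?thesis ..
  qed
  then obtain D where D: "\<And>i j. ((\<lambda>s. F s $ i $ j) has_real_derivative D i j) (at t)"
    by metis
  have "(F has_vector_derivative (\<chi> i j. D i j)) (at t)"
    by (rule has_vector_derivative_matrixI) (simp add: D)
  then show ?thesis
    using mderiv_eqI by metis
qed

section \<open>Integrability against a density with finite moments\<close>

lemma poly_inverse_bounded:
  fixes q :: "real poly"
  assumes "closed T" "\<And>t. t \<in> T \<Longrightarrow> poly q t \<noteq> 0"
  shows "\<exists>C. \<forall>t\<in>T. \<bar>1 / poly q t\<bar> \<le> C"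
proof (cases "degree q = 0")
  case True
  then obtain c where "q = [:c:]"
    by (rule degree_eq_zeroE)
  then show ?thesis by auto
next
  case False
  \<comment> \<open>A nonconstant polynomial is at least 1 in absolute value outside some ball. The
    part of \<open>T\<close> inside the ball is compact, and continuity bounds the reciprocal
    there.\<close>
  have "eventually (\<lambda>x. 1 \<le> norm (poly q x)) at_infinity"
    using filterlim_poly_at_infinity[of q] False
    by (auto simp: filterlim_at_infinity[of 0])
  then obtain R where R: "\<And>x. norm x \<ge> R \<Longrightarrow> 1 \<le> norm (poly q x)"
    unfolding eventually_at_infinity by blast
  have "compact (T \<inter> cball 0 R)"
    using assms(1) by (simp add: closed_Int_compact)
  moreover have "continuous_on (T \<inter> cball 0 R) (\<lambda>t. 1 / poly q t)"
    using assms(2) by (intro continuous_intros) auto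
  ultimately have "bounded ((\<lambda>t. 1 / poly q t) ` (T \<inter> cball 0 R))"
    by (intro compact_imp_bounded compact_continuous_image)
  then obtain C where "\<And>x. x \<in> (\<lambda>t. 1 / poly q t) ` (T \<inter> cball 0 R) \<Longrightarrow> norm x \<le> C"
    unfolding bounded_iff by blast
  then have C: "\<bar>1 / poly q t\<bar> \<le> C" if "t \<in> T" "norm t \<le> R" for t
    using that by fastforce
  have "\<bar>1 / poly q t\<bar> \<le> max C 1" if "t \<in> T" for t
  proof (cases "norm t \<le> R")
    case True
    then show ?thesis using C[OF that] by simp
  next
    case False
    then have "1 \<le> \<bar>poly q t\<bar>" using R[of t] by simp
    then have "\<bar>1 / poly q t\<bar> \<le> 1" by (simp add: divide_le_eq)
    then show ?thesis by simp
  qed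
  then show ?thesis by blast
qed

lemma set_integrable_sum:
  fixes f :: "'i \<Rightarrow> 'a \<Rightarrow> 'b::{banach, second_countable_topology}"
  assumes "\<And>i. i \<in> K \<Longrightarrow> set_integrable M A (f i)"
  shows "set_integrable M A (\<lambda>x. \<Sum>i\<in>K. f i x)"
  using assms unfolding set_integrable_def scaleR_sum_right by (rule Bochner_Integration.integrable_sum)

text \<open>A rational function without poles in the closed set \<open>T\<close> is bounded there by a polynomial,
  so finite moments suffice for integrability.\<close>

lemma set_integrable_rational_scaleR:
  fixes W :: "real \<Rightarrow> 'b::{banach, second_countable_topology}"
  assumes "closed T" "I \<subseteq> T" "I \<in> sets borel" "rational_on T f"
    and moments: "\<And>n::nat. set_integrable lborel I (\<lambda>t. t ^ n *\<^sub>R W t)"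
  shows "set_integrable lborel I (\<lambda>t. f t *\<^sub>R W t)"
proof -
  obtain p q where pq: "\<And>t. t \<in> T \<Longrightarrow> poly q t \<noteq> 0 \<and> f t = poly p t / poly q t"
    using assms(4) unfolding rational_on_def by metis
  obtain C where C: "\<And>t. t \<in> T \<Longrightarrow> \<bar>1 / poly q t\<bar> \<le> C"
    using poly_inverse_bounded[OF assms(1), of q] pq by blast
  have "(\<lambda>t. poly p t *\<^sub>R W t) = (\<lambda>t. \<Sum>k\<le>degree p. coeff p k *\<^sub>R t ^ k *\<^sub>R W t)"
    by (simp add: poly_altdef scaleR_sum_left)
  moreover have "set_integrable lborel I \<dots>"
    using moments by (intro set_integrable_sum set_integrable_scaleR_right) auto
  ultimately have pW: "set_integrable lborel I (\<lambda>t. poly p t *\<^sub>R W t)"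
    by simp
  show ?thesis
  proof (rule set_integrable_bound)
    show "set_integrable lborel I (\<lambda>t. C *\<^sub>R poly p t *\<^sub>R W t)"
      using pW by (intro set_integrable_scaleR_right)
    \<comment> \<open>For measurability, \<open>f W\<close> is written on \<open>I\<close> as the
      product of the continuous \<open>1 / q\<close> and the integrable \<open>p W\<close>; the
      indicator may occur twice, being idempotent.\<close>
    have "continuous_on I (\<lambda>t. 1 / poly q t)"
      using pq assms(2) by (intro continuous_intros) auto
    then have "(\<lambda>t. indicator I t *\<^sub>R (1 / poly q t)) \<in> borel_measurable lborel"
      unfolding measurable_lborel2 by (rule borel_measurable_continuous_on_indicator[OF assms(3)])
    moreover have "(\<lambda>t. indicator I t *\<^sub>R poly p t *\<^sub>R W t) \<in> borel_measurable lborel"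
      using pW by (auto simp: set_integrable_def)
    ultimately have "(\<lambda>t. (indicator I t *\<^sub>R (1 / poly q t)) *\<^sub>R indicator I t *\<^sub>R poly p t *\<^sub>R W t)
        \<in> borel_measurable lborel"
      by (rule borel_measurable_scaleR)
    also have "(\<lambda>t. (indicator I t *\<^sub>R (1 / poly q t)) *\<^sub>R indicator I t *\<^sub>R poly p t *\<^sub>R W t)
        = (\<lambda>t. indicator I t *\<^sub>R f t *\<^sub>R W t)"
      using pq assms(2) by (force simp: indicator_def)
    finally show "set_borel_measurable lborel I (\<lambda>t. f t *\<^sub>R W t)"
      by (simp add: set_borel_measurable_def)
    have "norm (f t *\<^sub>R W t) \<le> norm (C *\<^sub>R poly p t *\<^sub>R W t)" if "t \<in> I" for t
    proof -
      have "\<bar>f t\<bar> = \<bar>1 / poly q t\<bar> * \<bar>poly p t\<bar>"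
        using pq that assms(2) by (auto simp: abs_mult)
      also have "\<dots> \<le> \<bar>C\<bar> * \<bar>poly p t\<bar>"
        using C[of t] that assms(2) by (intro mult_right_mono) auto
      finally show ?thesis
        by (simp add: mult_right_mono flip: mult.assoc)
    qed
    then show "AE t in lborel. t \<in> I \<longrightarrow> norm (f t *\<^sub>R W t) \<le> norm (C *\<^sub>R poly p t *\<^sub>R W t)"
      by simp
  qed
qed

lemma set_integrable_bounded_linear:
  assumes "bounded_linear L" "set_integrable M A f"
  shows "set_integrable M A (\<lambda>x. L (f x))"
  using integrable_bounded_linear[OF assms[unfolded set_integrable_def]]
  by (simp add: set_integrable_def linear_simps(5)[OF assms(1)])

lemma set_integral_bounded_linear:
  assumes "bounded_linear L" "set_integrable M A f"
  shows "set_lebesgue_integral M A (\<lambda>x. L (f x)) = L (set_lebesgue_integral M A f)"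
  using integral_bounded_linear[OF assms[unfolded set_integrable_def]]
  by (simp add: set_lebesgue_integral_def linear_simps(5)[OF assms(1)])

text \<open>Expanding \<open>F\<close> in matrix units leaves scalar rational multiples of
  \<open>W\<close> under constant left factors. The scalar \<open>f\<close> is kept in the
  conclusion so that, after transposition, it has the form of the hypothesis \<open>W\<close> and
  the lemma can be applied a second time.\<close>

lemma set_integrable_rational_matrix_left:
  fixes W :: "'n::finite matfun"
  assumes W: "\<And>f. rational_on T f \<Longrightarrow> set_integrable M I (\<lambda>t. f t *\<^sub>R W t)"
    and F: "matrix_rational_on T F" and f: "rational_on T f"
  shows "set_integrable M I (\<lambda>t. f t *\<^sub>R (F t ** W t))"
proof -
  let ?E = "\<lambda>i j. axis i (axis j 1) :: real^'n^'n"
  have "F t ** W t = (\<Sum>i\<in>UNIV. \<Sum>j\<in>UNIV. F t $ i $ j *\<^sub>R ?E i j) ** W t" for t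
    by (rule arg_cong[where f = "\<lambda>M. M ** W t"], rule matrix_entry_expansion)
  then have eq: "f t *\<^sub>R (F t ** W t) =
      (\<Sum>i\<in>UNIV. \<Sum>j\<in>UNIV. ?E i j ** ((f t * F t $ i $ j) *\<^sub>R W t))" for t
    by (simp add: matrix_mult.sum_left matrix_mult.scaleR_left matrix_mult.scaleR_right
        scaleR_sum_right)
  have "set_integrable M I (\<lambda>t. ?E i j ** ((f t * F t $ i $ j) *\<^sub>R W t))" for i j
    using F f
    by (intro set_integrable_bounded_linear[OF matrix_mult.bounded_linear_right] W
        rational_on_mult) (auto simp: matrix_rational_on_entries)
  then show ?thesis
    unfolding eq by (intro set_integrable_sum) auto
qed

lemma set_integrable_transpose:
  fixes f :: "'a \<Rightarrow> real^'n^'m"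
  shows "set_integrable M A (\<lambda>t. transpose (f t)) \<longleftrightarrow> set_integrable M A f"
  using set_integrable_bounded_linear[OF bounded_linear_transpose, of M A f]
    set_integrable_bounded_linear[OF bounded_linear_transpose, of M A "\<lambda>t. transpose (f t)"]
  by auto

text \<open>The factor \<open>F\<close> is put on the left of \<open>W\<close>, the product is
  transposed, and then \<open>G\<close> is put on the left in the same way.\<close>

lemma set_integrable_rational_matrix_mult:
  fixes W :: "'n::finite matfun"
  assumes "closed T" "I \<subseteq> T" "I \<in> sets borel"
    and F: "matrix_rational_on T F" and G: "matrix_rational_on T G"
    and "\<And>n::nat. set_integrable lborel I (\<lambda>t. t ^ n *\<^sub>R W t)"
  shows "set_integrable lborel I (\<lambda>t. F t ** W t ** transpose (G t))"
proof -
  have W: "set_integrable lborel I (\<lambda>t. f t *\<^sub>R W t)" if "rational_on T f" for f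
    using assms(1-3) that assms(6) by (rule set_integrable_rational_scaleR)
  have "set_integrable lborel I (\<lambda>t. f t *\<^sub>R transpose (F t ** W t))" if "rational_on T f" for f
    using set_integrable_rational_matrix_left[OF W F that]
      set_integrable_transpose[of lborel I "\<lambda>t. f t *\<^sub>R (F t ** W t)"]
    by (simp add: transpose_scalar)
  from set_integrable_rational_matrix_left[OF this G rational_on_const[of T 1]]
  have "set_integrable lborel I (\<lambda>t. G t ** transpose (F t ** W t))"
    by simp
  then have "set_integrable lborel I (\<lambda>t. transpose (F t ** W t ** transpose (G t)))"
    by (simp add: matrix_transpose_mul transpose_transpose)
  then show ?thesis
    by (simp only: set_integrable_transpose)
qed

section \<open>Matrix polynomials\<close>

text \<open>The closure properties of matrix polynomials rest on this passage from matrix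
  coefficients to scalar polynomial entries.\<close>

lemma matrix_polynomial_entries:
  "matrix_polynomial f \<longleftrightarrow> (\<forall>i j. \<exists>p::real poly. \<forall>t. f t $ i $ j = poly p t)"
proof
  assume "matrix_polynomial f"
  then obtain p where p: "f = mat_poly_eval p"
    by (auto simp: matrix_polynomial_def)
  have "f t $ i $ j = poly (\<Sum>k\<le>degree p. monom (coeff p k $ i $ j) k) t" for i j t
    by (simp add: p mat_poly_eval_def poly_sum poly_monom mult.commute)
  then show "\<forall>i j. \<exists>p::real poly. \<forall>t. f t $ i $ j = poly p t"
    by blast
next
  assume "\<forall>i j. \<exists>p::real poly. \<forall>t. f t $ i $ j = poly p t"
  then obtain p :: "'a \<Rightarrow> 'a \<Rightarrow> real poly" where p: "\<And>i j t. f t $ i $ j = poly (p i j) t"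
    by metis
  \<comment> \<open>A common degree bound allows the entry polynomials to be glued, coefficient by
    coefficient, into one polynomial \<open>r\<close> with matrix coefficients.\<close>
  define n where "n = (MAX ij. degree (case ij of (i, j) \<Rightarrow> p i j))"
  have n: "degree (p i j) \<le> n" for i j
    unfolding n_def by (rule Max_ge) (auto intro: image_eqI[where x = "(i, j)"])
  define r :: "(real^'a^'a) poly" where "r = (\<Sum>k\<le>n. monom (\<chi> i j. coeff (p i j) k) k)"
  have r: "coeff r k = (\<chi> i j. coeff (p i j) k)" for k
  proof (cases "k \<le> n")
    case True
    then show ?thesis
      by (simp add: r_def coeff_sum sum.delta)
  next
    case False
    then have "coeff (p i j) k = 0" for i j
      using n[of i j] by (intro coeff_eq_0) simp
    with False show ?thesis
      by (simp add: r_def coeff_sum sum.delta vec_eq_iff)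
  qed
  have deg: "degree r \<le> n"
    unfolding r_def by (intro degree_sum_le) (auto intro: order.trans[OF degree_monom_le])
  have "f t = mat_poly_eval r t" for t
  proof -
    have "f t $ i $ j = mat_poly_eval r t $ i $ j" for i j
    proof -
      have "mat_poly_eval r t $ i $ j = (\<Sum>k\<le>degree r. coeff r k $ i $ j * t ^ k)"
        by (simp add: mat_poly_eval_def mult.commute)
      also have "\<dots> = (\<Sum>k\<le>n. coeff r k $ i $ j * t ^ k)"
        using deg by (intro sum.mono_neutral_left) (auto simp: coeff_eq_0)
      also have "\<dots> = (\<Sum>k\<le>degree (p i j). coeff (p i j) k * t ^ k)"
        unfolding r using n[of i j] by (simp, intro sum.mono_neutral_right) (auto simp: coeff_eq_0)
      also have "\<dots> = f t $ i $ j"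
        by (simp add: p poly_altdef)
      finally show ?thesis ..
    qed
    then show ?thesis
      by (simp add: vec_eq_iff)
  qed
  then show "matrix_polynomial f"
    by (auto simp: matrix_polynomial_def)
qed

lemma matrix_polynomial_const: "matrix_polynomial (\<lambda>t. c)"
  unfolding matrix_polynomial_entries by (intro allI exI[of _ "[:_:]"]) simp

lemma matrix_polynomial_add:
  "matrix_polynomial f \<Longrightarrow> matrix_polynomial g \<Longrightarrow> matrix_polynomial (\<lambda>t. f t + g t)"
  unfolding matrix_polynomial_entries by (simp, metis poly_add)

lemma matrix_polynomial_sum:
  "(\<And>n. n \<in> K \<Longrightarrow> matrix_polynomial (f n)) \<Longrightarrow> matrix_polynomial (\<lambda>t. \<Sum>n\<in>K. f n t)"
  by (induction K rule: infinite_finite_induct)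
    (auto intro: matrix_polynomial_const matrix_polynomial_add)

lemma matrix_polynomial_mult:
  assumes "matrix_polynomial f" "matrix_polynomial g"
  shows "matrix_polynomial (\<lambda>t. f t ** g t)"
proof -
  obtain p q where "\<And>i j t. f t $ i $ j = poly (p i j) t" "\<And>i j t. g t $ i $ j = poly (q i j) t"
    using assms unfolding matrix_polynomial_entries by metis
  then have "(f t ** g t) $ i $ j = poly (\<Sum>k\<in>UNIV. p i k * q k j) t" for i j t
    by (simp add: matrix_matrix_mult_def poly_sum)
  then show ?thesis
    unfolding matrix_polynomial_entries by blast
qed

lemma matrix_polynomial_uminus:
  "matrix_polynomial f \<Longrightarrow> matrix_polynomial (\<lambda>t. - f t)"
  unfolding matrix_polynomial_entries by (simp, metis poly_minus)

lemma matrix_polynomial_rational: "matrix_polynomial f \<Longrightarrow> matrix_rational_on T f"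
  unfolding matrix_polynomial_entries matrix_rational_on_entries
  by (metis (no_types, lifting) ext rational_on_poly)

lemma matrix_polynomial_has_derivative:
  assumes "matrix_polynomial f"
  shows "(f has_vector_derivative mderiv f t) (at t)"
  using matrix_rational_on_differentiable[OF matrix_polynomial_rational[OF assms], of UNIV UNIV]
  by simp

lemma matrix_polynomial_mderiv:
  assumes "matrix_polynomial f"
  shows "matrix_polynomial (mderiv f)"
proof -
  obtain p where p: "\<And>i j t. f t $ i $ j = poly (p i j) t"
    using assms unfolding matrix_polynomial_entries by metis
  have "(f has_vector_derivative (\<chi> i j. poly (pderiv (p i j)) t)) (at t)" for t
    by (rule has_vector_derivative_matrixI) (simp add: p)
  from mderiv_eqI[OF this] have "mderiv f t $ i $ j = poly (pderiv (p i j)) t" for i j t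
    by simp
  then show ?thesis
    unfolding matrix_polynomial_entries by blast
qed

lemma matrix_polynomial_diffop_order1:
  "matrix_polynomial E0 \<Longrightarrow> matrix_polynomial E1 \<Longrightarrow> matrix_polynomial y \<Longrightarrow>
    matrix_polynomial (diffop [E0, E1] y)"
  unfolding diffop_order1[abs_def]
  by (intro matrix_polynomial_add matrix_polynomial_mult matrix_polynomial_mderiv)

section \<open>The Darboux transformation\<close>

text \<open>This is the Leibniz rule. Since coefficients act from the right, those of the outer
  operator stand to the right of those of the inner one.\<close>

lemma diffop_order1_compose:
  assumes "open I" "t \<in> I"
    and y: "\<And>s. s \<in> I \<Longrightarrow> (y has_vector_derivative mderiv y s) (at s)"
    and y': "(mderiv y has_vector_derivative mderiv (mderiv y) t) (at t)"
    and A0: "(A0 has_vector_derivative A0') (at t)" and A1: "(A1 has_vector_derivative A1') (at t)"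
  shows "diffop [B0, B1] (diffop [A0, A1] y) t =
    diffop [\<lambda>s. A0 s ** B0 s + A0' ** B1 s, \<lambda>s. A1 s ** B0 s + A0 s ** B1 s + A1' ** B1 s,
      \<lambda>s. A1 s ** B1 s] y t"
proof -
  have "((\<lambda>s. y s ** A0 s + mderiv y s ** A1 s) has_vector_derivative
      (y t ** A0' + mderiv y t ** A0 t) + (mderiv y t ** A1' + mderiv (mderiv y) t ** A1 t)) (at t)"
    using assms(2) by (intro has_vector_derivative_add matrix_mult.has_vector_derivative y y' A0 A1)
  then have "mderiv (diffop [A0, A1] y) t =
      y t ** A0' + mderiv y t ** A0 t + mderiv y t ** A1' + mderiv (mderiv y) t ** A1 t"
    unfolding diffop_order1[abs_def] by (simp add: mderiv_eqI add.assoc)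
  then show ?thesis
    by (simp add: diffop_order1 diffop_order2 matrix_ring_simps add_ac)
qed

text \<open>Collects the data of the operator, the weight and \<open>P\<close>. The orthogonal
  family is added in a later locale, so that the factorization and Green's formula are available for
  general polynomials.\<close>

locale darboux_data =
  fixes a b :: ereal and I S :: "real set"
    and W F0 F1 F2 P U A1 :: "'n::finite matfun"
  assumes ab: "a < b"
    and I: "I = einterval a b"
    and S: "S = closure I"
    and W: "signed_weight I W" "smooth_on I W" "\<forall>t\<in>S. invertible (W t)"
    and F1: "matrix_rational_on S F1" and F2: "matrix_rational_on S F2"
    and sym2: "\<forall>t\<in>I. F2 t ** W t = W t ** transpose (F2 t)"
    and sym1: "\<forall>t\<in>I. 2 *\<^sub>R mderiv (\<lambda>s. F2 s ** W s) t
                 = W t ** transpose (F1 t) + F1 t ** W t"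
    and boundary: "\<forall>p. matrix_rational_on S p \<longrightarrow>
          ((\<lambda>x. p (real_of_ereal x) ** transpose (F2 (real_of_ereal x) ** W (real_of_ereal x)))
             \<longlongrightarrow> 0) (at_right a) \<and>
          ((\<lambda>x. p (real_of_ereal x) ** transpose (F2 (real_of_ereal x) ** W (real_of_ereal x)))
             \<longlongrightarrow> 0) (at_left b)"
    and P_smooth: "smooth_on S P"
    and P_kernel: "\<forall>t\<in>I. diffop [F0, F1, F2] P t = 0"
    and P_inv: "\<forall>t\<in>S. invertible (P t)"
    and P_sym: "\<forall>t\<in>I.
          ((1/2) *\<^sub>R F1 t + matrix_inv (P t) ** mderiv P t ** F2 t) ** W t
          = W t ** transpose ((1/2) *\<^sub>R F1 t + matrix_inv (P t) ** mderiv P t ** F2 t)"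
    and P'_inv: "finite {t\<in>I. \<not> invertible (mderiv P t)}"
    and U: "matrix_polynomial U"
    and A1: "\<forall>t\<in>I. invertible (mderiv P t) \<longrightarrow>
               A1 t = matrix_inv (mderiv P t) ** P t ** U t"
    and A1_poly: "matrix_polynomial A1"
    and A1_zeros: "\<forall>t\<in>S. det (A1 t) \<noteq> 0"
begin

abbreviation "A0 \<equiv> \<lambda>t. - U t"
text \<open>\<open>G\<close> is the rational function written as the inverse of \<open>P U\<close>
  times \<open>P'\<close> in the informal statement. \<open>Q\<close> will be the logarithmic
  derivative of \<open>P\<close>, and \<open>WW\<close> is the transformed weight.\<close>

abbreviation "G \<equiv> \<lambda>t. matrix_inv (A1 t)"
abbreviation "B1 \<equiv> \<lambda>t. G t ** F2 t"
abbreviation "B0 \<equiv> \<lambda>t. G t ** (F1 t - A0 t ** B1 t - mderiv A1 t ** B1 t)"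
abbreviation "DA \<equiv> diffop [A0, A1]"
abbreviation "DB \<equiv> diffop [B0, B1]"
abbreviation "DD \<equiv> diffop [F0, F1, F2]"
abbreviation "V \<equiv> \<lambda>t. F2 t ** W t"
abbreviation "Q \<equiv> \<lambda>t. U t ** G t"
abbreviation "WW \<equiv> \<lambda>t. G t ** V t ** transpose (G t)"

lemma open_I: "open I"
  by (simp add: I)

lemma I_borel: "I \<in> sets borel"
  using open_I by simp

lemma I_subset_S: "I \<subseteq> S"
  by (simp add: S closure_subset)

lemma closed_S: "closed S"
  by (simp add: S)

lemma G_cancel:
  assumes "t \<in> I"
  shows "A1 t ** G t = mat 1" "G t ** A1 t = mat 1"
    "M ** A1 t ** G t = M" "M ** G t ** A1 t = M"
  using assms I_subset_S A1_zeros matrix_inv_cancel[of "A1 t"] by (auto simp: invertible_det_nz)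

lemma rational_simps:
  "matrix_rational_on S F1" "matrix_rational_on S F2" "matrix_rational_on S U"
  "matrix_rational_on S A1" "matrix_rational_on S G" "matrix_rational_on S Q"
proof -
  show *: "matrix_rational_on S U" "matrix_rational_on S A1"
    using U A1_poly by (simp_all add: matrix_polynomial_rational)
  show "matrix_rational_on S G"
    using * A1_zeros by (intro matrix_rational_on_inv) auto
  with * show "matrix_rational_on S Q"
    by (intro matrix_rational_on_mult)
qed (fact F1 F2)+

lemma rational_derivative:
  "matrix_rational_on S F \<Longrightarrow> t \<in> I \<Longrightarrow> (F has_vector_derivative mderiv F t) (at t)"
  using matrix_rational_on_differentiable open_I I_subset_S by blast

lemma W_derivative: "t \<in> I \<Longrightarrow> (W has_vector_derivative mderiv W t) (at t)"
  using smooth_on_openE(1) W(2) open_I by blast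

text \<open>Halving \<open>sym1\<close> expresses the derivative of \<open>V\<close> through
  \<open>F1\<close> and \<open>W\<close>, free of derivatives of \<open>W\<close>.\<close>

lemma V_derivative:
  assumes "t \<in> I"
  shows "(V has_vector_derivative (1/2) *\<^sub>R (W t ** transpose (F1 t) + F1 t ** W t)) (at t)"
proof -
  have "mderiv V t = (1/2) *\<^sub>R 2 *\<^sub>R mderiv V t"
    by simp
  also have "\<dots> = (1/2) *\<^sub>R (W t ** transpose (F1 t) + F1 t ** W t)"
    using sym1 assms by simp
  finally show ?thesis
    using matrix_mult.has_vector_derivative[OF rational_derivative[OF rational_simps(2) assms]
        W_derivative[OF assms]] mderiv_eqI by metis
qed

lemma W_sym: "t \<in> I \<Longrightarrow> transpose (W t) = W t"
  using W(1) by (simp add: signed_weight_def)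

lemma V_sym: "t \<in> I \<Longrightarrow> transpose (V t) = V t"
  using sym2 W_sym by (simp add: matrix_transpose_mul)

lemma P_derivative: "t \<in> I \<Longrightarrow> (P has_vector_derivative mderiv P t) (at t)"
  and P'_derivative: "t \<in> I \<Longrightarrow> (mderiv P has_vector_derivative mderiv (mderiv P) t) (at t)"
  using smooth_on_openE[OF smooth_on_subset[OF P_smooth I_subset_S] open_I]
    smooth_on_openE(1)[OF smooth_on_openE(2)[OF smooth_on_subset[OF P_smooth I_subset_S] open_I] open_I]
  by blast+

lemma P_invertible: "t \<in> I \<Longrightarrow> invertible (P t)"
  using P_inv I_subset_S by blast

text \<open>The defining relation of \<open>A1\<close>, multiplied by \<open>P'\<close>, extends by continuity to the finitely
  many points where \<open>P'\<close> is singular.\<close>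

lemma P_U: "P t ** U t = mderiv P t ** A1 t" if t: "t \<in> I"
proof -
  define h where "h = (\<lambda>s. P s ** U s - mderiv P s ** A1 s)"
  have "isCont h t"
    unfolding h_def using t
    by (intro continuous_diff matrix_mult.isCont
        has_vector_derivative_continuous[OF P_derivative]
        has_vector_derivative_continuous[OF P'_derivative]
        has_vector_derivative_continuous[OF rational_derivative] rational_simps)
  then have "(h \<longlongrightarrow> h t) (at t)"
    by (simp add: isCont_def)
  moreover have "eventually (\<lambda>s. h s = 0) (at t)"
  proof -
    \<comment> \<open>Taking \<open>t\<close> itself out of the exceptional set keeps
      \<open>t\<close> inside the open set \<open>I - ?X\<close>, even if \<open>P'\<close> is
      singular at \<open>t\<close>.\<close>
    let ?X = "{t \<in> I. \<not> invertible (mderiv P t)} - {t}"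
    have "open (I - ?X)"
      using P'_inv by (intro open_Diff open_I finite_imp_closed) auto
    moreover have "h s = 0" if "s \<in> I - ?X" "s \<noteq> t" for s
    proof -
      have "invertible (mderiv P s)" "s \<in> I"
        using that by auto
      with A1 show ?thesis
        by (simp add: h_def matrix_mul_assoc matrix_inv_cancel)
    qed
    ultimately show ?thesis
      unfolding eventually_at_topological using t by blast
  qed
  then have "(h \<longlongrightarrow> 0) (at t)"
    by (rule tendsto_eventually)
  ultimately have "h t = 0"
    by (intro tendsto_unique[of "at t" h]) auto
  then show ?thesis
    by (simp add: h_def)
qed

text \<open>Multiplying \<open>P_U\<close> by \<open>G\<close> on the right solves for
  \<open>P'\<close>. The identity therefore holds also where \<open>P'\<close> is singular.\<close>

lemma P_log_derivative: "t \<in> I \<Longrightarrow> matrix_inv (P t) ** mderiv P t = Q t"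
proof -
  assume t: "t \<in> I"
  have "mderiv P t = mderiv P t ** A1 t ** G t"
    using t by (simp add: G_cancel)
  also have "\<dots> = P t ** U t ** G t"
    using t by (simp add: P_U)
  finally show ?thesis
    by (simp add: matrix_mul_assoc[symmetric] matrix_inv_cancel P_invertible[OF t])
qed

text \<open>This is \<open>P_U\<close> read as a differential equation for \<open>P\<close>.\<close>

lemma DA_P: "t \<in> I \<Longrightarrow> DA P t = 0"
  by (simp add: diffop_order1 P_U matrix_ring_simps)

text \<open>The first two coefficients of \<open>DB \<circ> DA\<close> agree with those of \<open>DD\<close> by construction; the last
  one does because both operators annihilate the invertible function \<open>P\<close>.\<close>

lemma factorization:
  assumes t: "t \<in> I"
    and y: "\<And>s. s \<in> I \<Longrightarrow> (y has_vector_derivative mderiv y s) (at s)"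
    and y': "(mderiv y has_vector_derivative mderiv (mderiv y) t) (at t)"
  shows "DB (DA y) t = DD y t"
proof -
  have 2: "A1 t ** B1 t = F2 t"
    using t by (simp add: matrix_mul_assoc G_cancel)
  have 1: "A1 t ** B0 t + A0 t ** B1 t + mderiv A1 t ** B1 t = F1 t"
    using t by (simp add: matrix_mul_assoc G_cancel)
  have A0': "(A0 has_vector_derivative mderiv A0 t) (at t)"
    by (intro matrix_polynomial_has_derivative matrix_polynomial_uminus U)
  have A1': "(A1 has_vector_derivative mderiv A1 t) (at t)"
    by (intro matrix_polynomial_has_derivative A1_poly)
  \<comment> \<open>Kept general in \<open>z\<close>: the case of \<open>P\<close> determines the
    zeroth coefficient, and the case of \<open>y\<close> then gives the claim.\<close>
  have compose: "DB (DA z) t =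
      z t ** (A0 t ** B0 t + mderiv A0 t ** B1 t) + mderiv z t ** F1 t + mderiv (mderiv z) t ** F2 t"
    if "\<And>s. s \<in> I \<Longrightarrow> (z has_vector_derivative mderiv z s) (at s)"
      "(mderiv z has_vector_derivative mderiv (mderiv z) t) (at t)" for z
    using diffop_order1_compose[OF open_I t that A0' A1', of B0 B1]
    unfolding diffop_order2 1 2 .
  have "DB (DA P) t = 0"
  proof -
    have "mderiv (DA P) t = mderiv (\<lambda>s. 0) t"
      by (rule mderiv_eq_on_open[OF open_I t]) (rule DA_P)
    also have "\<dots> = 0"
      by (rule mderiv_eqI) (rule has_vector_derivative_const)
    finally show ?thesis
      using DA_P[OF t] by (simp add: diffop_order1)
  qed
  then have "DB (DA P) t = DD P t"
    using P_kernel t by simp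
  then have "P t ** (A0 t ** B0 t + mderiv A0 t ** B1 t) = P t ** F0 t"
    using compose[OF P_derivative P'_derivative[OF t]] by (simp add: diffop_order2)
  from arg_cong[OF this, where f = "\<lambda>M. matrix_inv (P t) ** M"]
  have 0: "A0 t ** B0 t + mderiv A0 t ** B1 t = F0 t"
    unfolding matrix_inv_cancel(6)[OF P_invertible[OF t]] .
  show ?thesis
    using compose[of y] y y' unfolding 0 diffop_order2 by blast
qed

text \<open>The second summand is the derivative of \<open>V\<close>. Solving \<open>P_sym\<close>
  for \<open>V\<close> times the transpose of \<open>Q\<close> makes the terms with the transpose of
  \<open>F1\<close> cancel.\<close>

lemma V_Q:
  assumes "t \<in> I"
  shows "V t ** transpose (Q t) + (1/2) *\<^sub>R (W t ** transpose (F1 t) + F1 t ** W t)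
    = (F1 t + Q t ** F2 t) ** W t"
proof -
  have "(1/2) *\<^sub>R (F1 t ** W t) + Q t ** V t
      = (1/2) *\<^sub>R (W t ** transpose (F1 t)) + W t ** transpose (F2 t) ** transpose (Q t)"
    using bspec[OF P_sym assms] unfolding P_log_derivative[OF assms]
    by (simp add: matrix_ring_simps transpose_simps)
  moreover have "W t ** transpose (F2 t) = V t"
    using sym2 assms by simp
  ultimately have "V t ** transpose (Q t) =
      (1/2) *\<^sub>R (F1 t ** W t) + Q t ** V t - (1/2) *\<^sub>R (W t ** transpose (F1 t))"
    by (simp add: algebra_simps)
  moreover have "F1 t ** W t = (1/2) *\<^sub>R (F1 t ** W t) + (1/2) *\<^sub>R (F1 t ** W t)"
    using scaleR_left_distrib[of "1/2" "1/2" "F1 t ** W t"] by simp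
  ultimately show ?thesis
    by (simp add: matrix_ring_simps scaleR_add_right)
qed

text \<open>\<open>G\<close> is differentiable because it is rational; differentiating
  \<open>A1 G = 1\<close> on \<open>I\<close> then gives the formula.\<close>

lemma G_derivative:
  assumes t: "t \<in> I"
  shows "(G has_vector_derivative - (G t ** mderiv A1 t ** G t)) (at t)"
proof -
  have G': "(G has_vector_derivative mderiv G t) (at t)"
    using t by (intro rational_derivative rational_simps)
  then have "((\<lambda>s. A1 s ** G s) has_vector_derivative A1 t ** mderiv G t + mderiv A1 t ** G t) (at t)"
    by (rule matrix_mult.has_vector_derivative[OF matrix_polynomial_has_derivative[OF A1_poly]])
  then have "mderiv (\<lambda>s. A1 s ** G s) t = A1 t ** mderiv G t + mderiv A1 t ** G t"
    by (rule mderiv_eqI)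
  moreover have "mderiv (\<lambda>s. A1 s ** G s) t = mderiv (\<lambda>s. mat 1) t"
    by (rule mderiv_eq_on_open[OF open_I t]) (rule G_cancel)
  moreover have "mderiv (\<lambda>s. mat 1 :: real^'n^'n) t = 0"
    by (rule mderiv_eqI) (rule has_vector_derivative_const)
  ultimately have "A1 t ** mderiv G t = - (mderiv A1 t ** G t)"
    by (simp add: eq_neg_iff_add_eq_0)
  then have "G t ** (A1 t ** mderiv G t) = - (G t ** mderiv A1 t ** G t)"
    by (simp add: matrix_ring_simps)
  then show ?thesis
    using G' t by (simp add: matrix_mul_assoc G_cancel)
qed

text \<open>After \<open>V_Q\<close> the product rule produces the coefficient
  \<open>G (F1 + Q F2 - A1' G F2)\<close>, which is \<open>B0\<close> because
  \<open>A0 = - U\<close>. The identity serves both the formal adjoint and Green's formula.\<close>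

lemma DB_weighted:
  assumes t: "t \<in> I" and z: "(z has_vector_derivative mderiv z t) (at t)"
  shows "((\<lambda>s. z s ** G s ** V s) has_vector_derivative
    DB z t ** W t - z t ** G t ** V t ** transpose (Q t)) (at t)"
proof -
  have "((\<lambda>s. z s ** G s ** V s) has_vector_derivative
      z t ** G t ** ((1/2) *\<^sub>R (W t ** transpose (F1 t) + F1 t ** W t)) +
      (z t ** - (G t ** mderiv A1 t ** G t) + mderiv z t ** G t) ** V t) (at t)"
    using t by (intro matrix_mult.has_vector_derivative z G_derivative V_derivative)
  moreover have "(1/2) *\<^sub>R (W t ** transpose (F1 t) + F1 t ** W t) =
      (F1 t + Q t ** F2 t) ** W t - V t ** transpose (Q t)"
    using V_Q[OF t] by (simp add: eq_diff_eq add.commute)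
  moreover have "z t ** G t ** ((F1 t + Q t ** F2 t) ** W t - V t ** transpose (Q t)) +
      (z t ** - (G t ** mderiv A1 t ** G t) + mderiv z t ** G t) ** V t =
    DB z t ** W t - z t ** G t ** V t ** transpose (Q t)"
    unfolding diffop_order1 by (simp add: matrix_ring_simps algebra_simps)
  ultimately show ?thesis
    by simp
qed

lemma DA_eq: "t \<in> I \<Longrightarrow> DA y t = (mderiv y t - y t ** Q t) ** A1 t"
  by (simp add: diffop_order1 matrix_ring_simps G_cancel)

text \<open>The \<open>WW\<close>-integrand of \<open>p\<close> and \<open>q\<close> is the
  \<open>W\<close>-integrand of the rational functions \<open>p G F2\<close> and
  \<open>q G\<close>.\<close>

lemma WW_integrable:
  assumes "matrix_rational_on S p" "matrix_rational_on S q"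
  shows "mat_ip_exists I WW p q"
proof -
  have "matrix_rational_on S (\<lambda>t. p t ** G t ** F2 t)" "matrix_rational_on S (\<lambda>t. q t ** G t)"
    using assms by (intro matrix_rational_on_mult rational_simps; simp)+
  with W(1) have "set_integrable lborel I
      (\<lambda>t. p t ** G t ** F2 t ** W t ** transpose (q t ** G t))"
    by (intro set_integrable_rational_matrix_mult[OF closed_S I_subset_S I_borel])
      (auto simp: signed_weight_def)
  then show ?thesis
    by (simp add: mat_ip_exists_def matrix_ring_simps transpose_simps)
qed

lemma W_integrable:
  assumes "matrix_rational_on S p" "matrix_rational_on S q"
  shows "mat_ip_exists I W p q"
  using W(1) assms unfolding mat_ip_exists_def
  by (intro set_integrable_rational_matrix_mult[OF closed_S I_subset_S I_borel])
    (auto simp: signed_weight_def)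

end

section \<open>Left matrix combinations, inner products and boundary terms\<close>

lemma funpow_mderiv_left_sum:
  assumes "\<And>n. n \<in> K \<Longrightarrow> matrix_polynomial (p n)"
  shows "(mderiv ^^ j) (\<lambda>t. \<Sum>n\<in>K. C n ** p n t) = (\<lambda>t. \<Sum>n\<in>K. C n ** (mderiv ^^ j) (p n) t)"
  using assms
proof (induction j arbitrary: p)
  case (Suc j)
  have "((\<lambda>t. \<Sum>n\<in>K. C n ** p n t) has_vector_derivative (\<Sum>n\<in>K. C n ** mderiv (p n) t)) (at t)"
    for t
    using Suc.prems
    by (intro has_vector_derivative_sum matrix_polynomial_has_derivative
        bounded_linear.has_vector_derivative[OF matrix_mult.bounded_linear_right])
  then have "mderiv (\<lambda>t. \<Sum>n\<in>K. C n ** p n t) = (\<lambda>t. \<Sum>n\<in>K. C n ** mderiv (p n) t)"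
    using mderiv_eqI by blast
  \<comment> \<open>The innermost derivative is split off, so that the induction hypothesis applies
    to the family \<open>mderiv (p n)\<close>.\<close>
  with Suc show ?case
    by (simp add: funpow_Suc_right matrix_polynomial_mderiv del: funpow.simps)
qed simp

lemma diffop_left_sum:
  assumes "\<And>n. n \<in> K \<Longrightarrow> matrix_polynomial (p n)"
  shows "diffop Es (\<lambda>t. \<Sum>n\<in>K. C n ** p n t) t = (\<Sum>n\<in>K. C n ** diffop Es (p n) t)"
proof -
  have "diffop Es (\<lambda>t. \<Sum>n\<in>K. C n ** p n t) t =
      (\<Sum>j<length Es. \<Sum>n\<in>K. C n ** (mderiv ^^ j) (p n) t ** (Es ! j) t)"
    unfolding diffop_def by (simp add: funpow_mderiv_left_sum[OF assms] matrix_mult.sum_left)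
  also have "\<dots> = (\<Sum>n\<in>K. C n ** diffop Es (p n) t)"
    unfolding diffop_def matrix_mult.sum_right matrix_mul_assoc by (rule sum.swap)
  finally show ?thesis .
qed

lemma diffop_left_mult:
  "matrix_polynomial p \<Longrightarrow> diffop Es (\<lambda>t. C ** p t) t = C ** diffop Es p t"
  using diffop_left_sum[of "{()}" "\<lambda>_. p" Es "\<lambda>_. C" t] by simp

text \<open>Lets identities known on \<open>I\<close> only be inserted into a first order
  operator.\<close>

lemma diffop_order1_cong:
  assumes "open I" "t \<in> I" "\<And>s. s \<in> I \<Longrightarrow> f s = g s"
  shows "diffop [E0, E1] f t = diffop [E0, E1] g t"
  unfolding diffop_order1 using mderiv_eq_on_open[OF assms] assms(2,3) by simp

lemma mat_ip_transpose:
  assumes "\<And>t. t \<in> I \<Longrightarrow> transpose (V t) = V t" "I \<in> sets borel" "mat_ip_exists I V p q"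
  shows "mat_ip I V q p = transpose (mat_ip I V p q)"
proof -
  have "mat_ip I V q p = set_lebesgue_integral lborel I (\<lambda>t. transpose (p t ** V t ** transpose (q t)))"
    unfolding mat_ip_def using assms(1,2)
    by (intro set_lebesgue_integral_cong) (auto simp: matrix_transpose_mul matrix_mul_assoc)
  also have "\<dots> = transpose (mat_ip I V p q)"
    using assms(3) unfolding mat_ip_def mat_ip_exists_def
    by (intro set_integral_bounded_linear bounded_linear_transpose)
  finally show ?thesis .
qed

lemma mat_ip_cong:
  assumes "I \<in> sets borel" "\<And>t. t \<in> I \<Longrightarrow> p t = p' t" "\<And>t. t \<in> I \<Longrightarrow> q t = q' t"
  shows "mat_ip I V p q = mat_ip I V p' q'" "mat_ip_exists I V p q \<longleftrightarrow> mat_ip_exists I V p' q'"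
proof -
  show "mat_ip I V p q = mat_ip I V p' q'"
    unfolding mat_ip_def using assms by (intro set_lebesgue_integral_cong) auto
  show "mat_ip_exists I V p q \<longleftrightarrow> mat_ip_exists I V p' q'"
    unfolding mat_ip_exists_def using assms by (intro set_integrable_cong) auto
qed

lemma mat_ip_left_mult:
  assumes "mat_ip_exists I V p q"
  shows "mat_ip I V (\<lambda>t. C ** p t) q = C ** mat_ip I V p q"
  using set_integral_bounded_linear[OF matrix_mult.bounded_linear_right[of C]
      assms[unfolded mat_ip_exists_def]]
  by (simp add: mat_ip_def matrix_mul_assoc)

text \<open>The boundary condition controls left multiples of \<open>M\<close> only; a rational factor on the right
  is moved to the left entry by entry.\<close>

lemma tendsto_rational_sandwich:
  fixes M :: "'n::finite matfun"
  assumes lim: "\<And>p. matrix_rational_on S p \<Longrightarrow> ((\<lambda>x. p (r x) ** M (r x)) \<longlongrightarrow> 0) F"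
    and p: "matrix_rational_on S p" and q: "matrix_rational_on S q"
  shows "((\<lambda>x. p (r x) ** M (r x) ** transpose (q (r x))) \<longlongrightarrow> 0) F"
proof (intro vec_tendstoI)
  fix i j
  have "(p t ** M t ** transpose (q t)) $ i $ j = (\<Sum>l\<in>UNIV. ((q t $ j $ l *\<^sub>R p t) ** M t) $ i $ l)"
    for t
    by (simp add: matrix_mult.scaleR_left) (simp add: matrix_matrix_mult_def transpose_def mult.commute)
  moreover have "((\<lambda>x. \<Sum>l\<in>UNIV. ((q (r x) $ j $ l *\<^sub>R p (r x)) ** M (r x)) $ i $ l) \<longlongrightarrow>
      (\<Sum>l\<in>(UNIV::'n set). (0 :: real^'n^'n) $ i $ l)) F"
    using p q
    by (intro tendsto_sum tendsto_vec_nth lim matrix_rational_on_scaleR)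
      (auto simp: matrix_rational_on_entries)
  ultimately show "((\<lambda>x. (p (r x) ** M (r x) ** transpose (q (r x))) $ i $ j) \<longlongrightarrow> (0 :: real^'n^'n) $ i $ j) F"
    by simp
qed

section \<open>Green's formula and the formal adjoint\<close>

context darboux_data
begin

lemma DA_polynomial: "matrix_polynomial y \<Longrightarrow> matrix_polynomial (DA y)"
  by (intro matrix_polynomial_diffop_order1 matrix_polynomial_uminus U A1_poly)

lemma WW_sym: "transpose (WW t) = WW t" if "t \<in> I"
proof -
  have "transpose (WW t) = G t ** transpose (V t) ** transpose (G t)"
    by (simp only: matrix_transpose_mul transpose_transpose matrix_mul_assoc)
  also have "\<dots> = WW t"
    using that by (simp only: V_sym)
  finally show ?thesis .
qed

lemma DB_DA:
  "matrix_polynomial y \<Longrightarrow> t \<in> I \<Longrightarrow> DB (DA y) t = DD y t"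
  by (intro factorization matrix_polynomial_has_derivative matrix_polynomial_mderiv)

text \<open>\<open>DB_weighted\<close> is applied to \<open>DA y\<close> and multiplied by the
  transpose of \<open>w\<close>. The term with \<open>Q\<close> completes \<open>w'\<close> to
  \<open>w' - w Q\<close>, which is \<open>DA w\<close> times \<open>G\<close>. \<open>V\<close>
  appears transposed to match the boundary hypothesis.\<close>

lemma green_integrand:
  assumes t: "t \<in> I" and y: "matrix_polynomial y" and w: "matrix_polynomial w"
  shows "((\<lambda>s. (mderiv y s - y s ** Q s) ** transpose (V s) ** transpose (w s)) has_vector_derivative
    DA y t ** WW t ** transpose (DA w t) + DD y t ** W t ** transpose (w t)) (at t)"
proof -
  have "((\<lambda>s. DA y s ** G s ** V s) has_vector_derivative
      DD y t ** W t - DA y t ** G t ** V t ** transpose (Q t)) (at t)"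
    using DB_weighted[OF t matrix_polynomial_has_derivative[OF DA_polynomial[OF y]]]
    unfolding DB_DA[OF y t] .
  from matrix_mult.has_vector_derivative[OF this bounded_linear.has_vector_derivative[OF
      bounded_linear_transpose matrix_polynomial_has_derivative[OF w]]]
  have "((\<lambda>s. DA y s ** G s ** V s ** transpose (w s)) has_vector_derivative
      DA y t ** G t ** V t ** transpose (mderiv w t) +
      (DD y t ** W t - DA y t ** G t ** V t ** transpose (Q t)) ** transpose (w t)) (at t)" .
  moreover have "DA y s ** G s ** V s ** transpose (w s) =
      (mderiv y s - y s ** Q s) ** transpose (V s) ** transpose (w s)" if "s \<in> I" for s
    using that by (simp only: DA_eq V_sym G_cancel)
  ultimately have *: "((\<lambda>s. (mderiv y s - y s ** Q s) ** transpose (V s) ** transpose (w s))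
      has_vector_derivative DA y t ** G t ** V t ** transpose (mderiv w t) +
      (DD y t ** W t - DA y t ** G t ** V t ** transpose (Q t)) ** transpose (w t)) (at t)"
    by (rule has_vector_derivative_transform_within_open[OF _ open_I t])
  have "transpose (G t) ** transpose (DA w t) = transpose (mderiv w t - w t ** Q t)"
    unfolding matrix_transpose_mul[symmetric] DA_eq[OF t] G_cancel(3)[OF t] ..
  then have "DA y t ** WW t ** transpose (DA w t) =
      DA y t ** G t ** V t ** transpose (mderiv w t - w t ** Q t)"
    by (simp only: matrix_mul_assoc[symmetric])
  also have "\<dots> = DA y t ** G t ** V t ** transpose (mderiv w t) -
      DA y t ** G t ** V t ** transpose (Q t) ** transpose (w t)"
    by (simp only: matrix_transpose_mul linear_simps(2)[OF bounded_linear_transpose]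
      matrix_mult.diff_right matrix_mul_assoc)
  finally have "DA y t ** G t ** V t ** transpose (mderiv w t) +
      (DD y t ** W t - DA y t ** G t ** V t ** transpose (Q t)) ** transpose (w t) =
      DA y t ** WW t ** transpose (DA w t) + DD y t ** W t ** transpose (w t)"
    by (simp add: matrix_mult.diff_left)
  with * show ?thesis
    by simp
qed

text \<open>Integrates \<open>green_integrand\<close> over \<open>I\<close>. The polynomial
  \<open>z\<close> represents \<open>DD y\<close> there and makes the second term continuous and
  integrable.\<close>

lemma green:
  assumes y: "matrix_polynomial y" and w: "matrix_polynomial w" and z: "matrix_polynomial z"
    and yz: "\<And>t. t \<in> I \<Longrightarrow> DD y t = z t"
  shows "mat_ip I WW (DA y) (DA w) = - mat_ip I W z w"
proof -
  let ?F = "\<lambda>s. (mderiv y s - y s ** Q s) ** transpose (V s) ** transpose (w s)"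
  let ?g = "\<lambda>t. DA y t ** WW t ** transpose (DA w t)"
  let ?h = "\<lambda>t. z t ** W t ** transpose (w t)"
  have g: "set_integrable lborel I ?g" and h: "set_integrable lborel I ?h"
    using WW_integrable[of "DA y" "DA w"] W_integrable[of z w]
      matrix_polynomial_rational DA_polynomial y w z
    unfolding mat_ip_exists_def by blast+
  have poly_cont: "isCont f t" if "matrix_polynomial f" for f :: "'n matfun" and t
    using matrix_polynomial_has_derivative[OF that] has_vector_derivative_continuous by blast
  have transpose_cont: "isCont (\<lambda>s. transpose (f s)) t" if "isCont f t" for f :: "'n matfun" and t
    using that by (rule bounded_linear.isCont[OF bounded_linear_transpose])
  have \<eta>: "matrix_rational_on S (\<lambda>s. mderiv y s - y s ** Q s)"
    using y by (intro matrix_rational_on_diff matrix_rational_on_mult rational_simps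
        matrix_polynomial_rational matrix_polynomial_mderiv)
  \<comment> \<open>The two zeros are the limits of \<open>?F\<close> at the endpoints, which may be
    infinite.\<close>
  have "(LBINT t=a..b. ?g t + ?h t) = 0 - 0"
  proof (rule interval_integral_FTC_integrable[OF ab])
    fix t assume "a < ereal t" "ereal t < b"
    then have t: "t \<in> I"
      by (simp add: I einterval_def)
    show "(?F has_vector_derivative ?g t + ?h t) (at t)"
      using green_integrand[OF t y w] yz[OF t] by simp
    have "isCont G t" "isCont F2 t" "isCont W t"
      using has_vector_derivative_continuous G_derivative[OF t] W_derivative[OF t]
        rational_derivative[OF rational_simps(2) t] by blast+
    moreover have "isCont (DA y) t" "isCont (DA w) t" "isCont z t" "isCont w t"
      by (intro poly_cont DA_polynomial y w z)+
    ultimately show "isCont (\<lambda>t. ?g t + ?h t) t"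
      by (intro continuous_add matrix_mult.isCont transpose_cont)
  next
    show "set_integrable lborel (einterval a b) (\<lambda>t. ?g t + ?h t)"
      using g h by (simp add: I)
    show "((?F \<circ> real_of_ereal) \<longlongrightarrow> 0) (at_right a)" "((?F \<circ> real_of_ereal) \<longlongrightarrow> 0) (at_left b)"
      unfolding comp_def using boundary
      by (intro tendsto_rational_sandwich[where M = "\<lambda>t. transpose (V t)", OF _ \<eta>
            matrix_polynomial_rational[OF w]]; blast)+
  qed
  then have "set_lebesgue_integral lborel I (\<lambda>t. ?g t + ?h t) = 0"
    using less_imp_le[OF ab] by (simp add: interval_lebesgue_integral_def I)
  then show ?thesis
    using g h by (simp add: mat_ip_def set_integral_add eq_neg_iff_add_eq_0)
qed

text \<open>The intertwining relation: \<open>DB (DA y)\<close> agrees with \<open>z\<close> on the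
  open set \<open>I\<close>, hence so do their images under \<open>DA\<close>.\<close>

lemma DA_DB_DA:
  assumes "matrix_polynomial y" "\<And>t. t \<in> I \<Longrightarrow> DD y t = z t" "t \<in> I"
  shows "DA (DB (DA y)) t = DA z t"
  using assms DB_DA by (intro diffop_order1_cong[OF open_I]) auto

text \<open>Both sides equal \<open>- mat_ip I W z v\<close>. Green's formula trades
  \<open>DA\<close> for \<open>DD\<close> in the first argument only, so the left side is transposed
  before and after its use.\<close>

lemma symmetric_DA:
  assumes "matrix_polynomial y" "matrix_polynomial z" "\<And>t. t \<in> I \<Longrightarrow> DD y t = z t"
    and "matrix_polynomial w" "matrix_polynomial v" "\<And>t. t \<in> I \<Longrightarrow> DD w t = v t"
  shows "mat_ip I WW (DA z) (DA w) = mat_ip I WW (DA y) (DA v)"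
proof -
  have "mat_ip I WW (DA z) (DA w) = transpose (mat_ip I WW (DA w) (DA z))"
    using assms by (intro mat_ip_transpose WW_sym I_borel WW_integrable
        matrix_polynomial_rational DA_polynomial)
  also have "\<dots> = - transpose (mat_ip I W v z)"
    using green[OF assms(4) assms(2) assms(5,6)]
    by (simp add: linear_simps(4)[OF bounded_linear_transpose])
  also have "transpose (mat_ip I W v z) = mat_ip I W z v"
    using assms by (intro mat_ip_transpose[symmetric] W_sym I_borel W_integrable
        matrix_polynomial_rational)
  also have "- \<dots> = mat_ip I WW (DA y) (DA v)"
    using green[OF assms(1) assms(5) assms(2,3)] by simp
  finally show ?thesis .
qed

text \<open>For \<open>z = y G F2\<close> one has \<open>z W = y G V\<close>, so
  \<open>DB_weighted\<close> computes the derivative in the adjoint. The two terms with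
  \<open>Q\<close> cancel and \<open>- DB y\<close> times \<open>W\<close> remains, from which the
  inverse of \<open>W\<close> removes the weight.\<close>

lemma DB_formal_adjoint:
  assumes y: "smooth_on I y" and t: "t \<in> I"
  shows "DB y t = - ((formal_adjoint W [\<lambda>s. - (matrix_inv (P s) ** mderiv P s), \<lambda>s. mat 1]
    \<circ> diffop [\<lambda>s. G s ** F2 s]) y t)"
proof -
  have eq: "diffop [\<lambda>s. G s ** F2 s] y s ** W s = y s ** G s ** V s" for s
    by (simp add: diffop_def matrix_mul_assoc)
  have *: "mderiv (\<lambda>s. y s ** G s ** V s) t = DB y t ** W t - y t ** G t ** V t ** transpose (Q t)"
    using smooth_on_openE(1)[OF y open_I t] by (intro mderiv_eqI DB_weighted t)
  have "(formal_adjoint W [\<lambda>s. - (matrix_inv (P s) ** mderiv P s), \<lambda>s. mat 1]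
      \<circ> diffop [\<lambda>s. G s ** F2 s]) y t =
      (y t ** G t ** V t ** transpose (- Q t) - mderiv (\<lambda>s. y s ** G s ** V s) t) **
        matrix_inv (W t)"
    unfolding formal_adjoint_def comp_def eq
    by (simp add: lessThan_Suc eval_nat_numeral P_log_derivative[OF t] eq)
  also have "y t ** G t ** V t ** transpose (- Q t) - mderiv (\<lambda>s. y s ** G s ** V s) t =
      - (DB y t ** W t)"
    unfolding * linear_simps(4)[OF bounded_linear_transpose] matrix_mult.minus_right by simp
  also have "- (DB y t ** W t) ** matrix_inv (W t) = - (DB y t ** W t ** matrix_inv (W t))"
    by (rule matrix_mult.minus_left)
  also have "\<dots> = - DB y t"
    using W(3) t I_subset_S matrix_inv_cancel(3)[of "W t"] by auto
  finally show ?thesis by simp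
qed

end

section \<open>The transformed eigenfunctions: orthogonality and symmetry\<close>

locale darboux_eigenfunctions = darboux_data a b I S W F0 F1 F2 P U A1
  for a b I S and W F0 F1 F2 P U A1 :: "'n::finite matfun" +
  fixes J :: "nat set" and p :: "nat \<Rightarrow> 'n matfun" and \<Gamma> :: "nat \<Rightarrow> real^'n^'n"
  assumes p_poly: "n \<in> J \<Longrightarrow> matrix_polynomial (p n)"
    and p_eigen: "n \<in> J \<Longrightarrow> t \<in> I \<Longrightarrow> DD (p n) t = \<Gamma> n ** p n t"
    and p_orth: "orthogonal_family I W J p"
begin

text \<open>The intertwining relation with \<open>z = \<Gamma> n ** p n\<close>; constant left
  factors commute with operators whose coefficients act from the right.\<close>

lemma DA_eigen:
  assumes "n \<in> J" "t \<in> I"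
  shows "DA (DB (DA (p n))) t = \<Gamma> n ** DA (p n) t"
  using DA_DB_DA[OF p_poly p_eigen] diffop_left_mult[OF p_poly] assms by simp

text \<open>By Green's formula the product of two images is \<open>- \<Gamma> n\<close> times the
  \<open>W\<close>-product of \<open>p n\<close> and \<open>p m\<close>.\<close>

lemma DA_orthogonal: "orthogonal_family I WW J (\<lambda>n. DA (p n))"
  unfolding orthogonal_family_def
proof (intro ballI conjI impI)
  fix n m assume nm: "n \<in> J" "m \<in> J"
  then show "mat_ip_exists I WW (DA (p n)) (DA (p m))"
    by (intro WW_integrable matrix_polynomial_rational DA_polynomial p_poly)
  assume "n \<noteq> m"
  with nm p_orth have "mat_ip_exists I W (p n) (p m)" "mat_ip I W (p n) (p m) = 0"
    by (auto simp: orthogonal_family_def)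
  then show "mat_ip I WW (DA (p n)) (DA (p m)) = 0"
    using nm p_eigen
    by (subst green[where z = "\<lambda>t. \<Gamma> n ** p n t"])
      (auto intro: p_poly matrix_polynomial_mult matrix_polynomial_const simp: mat_ip_left_mult)
qed

text \<open>A combination of images is the image \<open>DA y\<close> of the same combination of the
  \<open>p n\<close>, and inserting the \<open>\<Gamma> n\<close> gives the polynomial
  \<open>z\<close>. This brings the span into the form required by
  \<open>symmetric_DA\<close>.\<close>

lemma left_span_DA:
  assumes "f \<in> left_span J (\<lambda>n. DA (p n))"
  obtains y z where "matrix_polynomial y" "matrix_polynomial z" "f = DA y"
    "\<And>t. t \<in> I \<Longrightarrow> DD y t = z t"
proof -
  obtain K C where K: "K \<subseteq> J" and f: "f = (\<lambda>t. \<Sum>n\<in>K. C n ** DA (p n) t)"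
    using assms by (auto simp: left_span_def)
  have p: "matrix_polynomial (p n)" if "n \<in> K" for n
    using that K p_poly by blast
  show ?thesis
  proof
    show "matrix_polynomial (\<lambda>t. \<Sum>n\<in>K. C n ** p n t)"
      "matrix_polynomial (\<lambda>t. \<Sum>n\<in>K. C n ** (\<Gamma> n ** p n t))"
      by (intro matrix_polynomial_sum matrix_polynomial_mult matrix_polynomial_const p; assumption)+
    show "f = DA (\<lambda>t. \<Sum>n\<in>K. C n ** p n t)"
      unfolding f by (rule ext, rule diffop_left_sum[OF p, symmetric])
    show "DD (\<lambda>t. \<Sum>n\<in>K. C n ** p n t) t = (\<Sum>n\<in>K. C n ** (\<Gamma> n ** p n t))" if "t \<in> I" for t
      using p_eigen[OF _ that] K by (subst diffop_left_sum[OF p]) (auto intro!: sum.cong)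
  qed
qed

text \<open>On the span, \<open>DA \<circ> DB\<close> takes \<open>DA y\<close> to the polynomial
  \<open>DA z\<close>, though only on \<open>I\<close>. Congruence of the inner products under
  equality on \<open>I\<close> then reduces the claim to \<open>symmetric_DA\<close>.\<close>

lemma DA_DB_symmetric:
  "symmetric_wrt_pair I WW (left_span J (\<lambda>n. DA (p n))) (DA \<circ> DB)"
  unfolding symmetric_wrt_pair_def
proof (intro conjI ballI)
  fix f assume "f \<in> left_span J (\<lambda>n. DA (p n))"
  then obtain y z where y: "matrix_polynomial y" "matrix_polynomial z" "f = DA y"
    "\<And>t. t \<in> I \<Longrightarrow> DD y t = z t"
    using left_span_DA by blast
  have f: "(DA \<circ> DB) f t = DA z t" if "t \<in> I" for t
    using DA_DB_DA[OF y(1,4) that] y(3) by simp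
  then show "\<exists>r. matrix_polynomial r \<and> (\<forall>t\<in>I. (DA \<circ> DB) f t = r t)"
    using DA_polynomial[OF y(2)] by (intro exI[of _ "DA z"]) simp
  fix g assume "g \<in> left_span J (\<lambda>n. DA (p n))"
  then obtain w v where w: "matrix_polynomial w" "matrix_polynomial v" "g = DA w"
    "\<And>t. t \<in> I \<Longrightarrow> DD w t = v t"
    using left_span_DA by blast
  have g: "(DA \<circ> DB) g t = DA v t" if "t \<in> I" for t
    using DA_DB_DA[OF w(1,4) that] w(3) by simp
  note integrable = WW_integrable[OF matrix_polynomial_rational matrix_polynomial_rational]
  have left: "mat_ip I WW ((DA \<circ> DB) f) g = mat_ip I WW (DA z) g"
    "mat_ip_exists I WW ((DA \<circ> DB) f) g \<longleftrightarrow> mat_ip_exists I WW (DA z) g"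
    by (intro mat_ip_cong I_borel f refl; assumption)+
  have right: "mat_ip I WW f ((DA \<circ> DB) g) = mat_ip I WW f (DA v)"
    "mat_ip_exists I WW f ((DA \<circ> DB) g) \<longleftrightarrow> mat_ip_exists I WW f (DA v)"
    by (intro mat_ip_cong I_borel g refl; assumption)+
  show "mat_ip_exists I WW ((DA \<circ> DB) f) g"
    unfolding left unfolding w(3) by (intro integrable DA_polynomial y w)
  show "mat_ip_exists I WW f ((DA \<circ> DB) g)"
    unfolding right unfolding y(3) by (intro integrable DA_polynomial y w)
  show "mat_ip I WW ((DA \<circ> DB) f) g = mat_ip I WW f ((DA \<circ> DB) g)"
    unfolding left right unfolding y(3) w(3) by (intro symmetric_DA y w)
qed

end

text \<open>The operator identities are expressed through the action on functions smooth on
  \<open>I\<close>. The first conjunct justifies writing \<open>matrix_inv (A1 t)\<close> for the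
  inverse of \<open>P U\<close> times \<open>P'\<close> in the other formulas.\<close>

theorem theorem10:
  fixes a b :: ereal
    and I S :: "real set"
    and W F0 F1 F2 P U A0 A1 B0 B1 \<W> :: "'n::finite matfun"
    and X :: "nat set"
    and Pn \<P> :: "nat \<Rightarrow> 'n matfun"
    and \<Gamma> :: "nat \<Rightarrow> real^'n^'n"
    and D \<A> \<B> \<D> :: "'n matfun \<Rightarrow> 'n matfun"
    and \<AA> :: "'n matfun set"
  assumes "a < b"
    and I: "I = einterval a b"
    and S: "S = closure I"
    and W: "signed_weight I W" "smooth_on I W" "\<forall>t\<in>S. invertible (W t)"
    and F: "matrix_rational_on S F0" "matrix_rational_on S F1" "matrix_rational_on S F2"
    and F2_inv: "\<forall>t\<in>I. invertible (F2 t)"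
    and D: "D = diffop [F0, F1, F2]"
    and sym2: "\<forall>t\<in>I. F2 t ** W t = W t ** transpose (F2 t)"
    and sym1: "\<forall>t\<in>I. 2 *\<^sub>R mderiv (\<lambda>s. F2 s ** W s) t
                 = W t ** transpose (F1 t) + F1 t ** W t"
    and boundary: "\<forall>p. matrix_rational_on S p \<longrightarrow>
          ((\<lambda>x. p (real_of_ereal x) ** transpose (F2 (real_of_ereal x) ** W (real_of_ereal x)))
             \<longlongrightarrow> 0) (at_right a) \<and>
          ((\<lambda>x. p (real_of_ereal x) ** transpose (F2 (real_of_ereal x) ** W (real_of_ereal x)))
             \<longlongrightarrow> 0) (at_left b)"
    and X: "finite X"
    and Pn_poly: "\<forall>n\<in>- X. matrix_polynomial_regular n (Pn n)"
    and Pn_orth: "orthogonal_family I W (- X) Pn"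
    and Pn_norm: "\<forall>n\<in>- X. invertible (mat_ip I W (Pn n) (Pn n))"
    and Pn_eigen: "\<forall>n\<in>- X. \<forall>t\<in>I. D (Pn n) t = \<Gamma> n ** Pn n t"
    and P_smooth: "smooth_on S P"
    and P_kernel: "\<forall>t\<in>I. D P t = 0"
    and P_inv: "\<forall>t\<in>S. invertible (P t)"
    and P_sym: "\<forall>t\<in>I.
          ((1/2) *\<^sub>R F1 t + matrix_inv (P t) ** mderiv P t ** F2 t) ** W t
          = W t ** transpose ((1/2) *\<^sub>R F1 t + matrix_inv (P t) ** mderiv P t ** F2 t)"
    and P'_inv: "finite {t\<in>I. \<not> invertible (mderiv P t)}"
    and U: "matrix_polynomial U"
    and A1: "\<forall>t\<in>I. invertible (mderiv P t) \<longrightarrow>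
               A1 t = matrix_inv (mderiv P t) ** P t ** U t"
    and A1_poly: "matrix_polynomial A1"
    and A1_zeros: "\<forall>t\<in>S. det (A1 t) \<noteq> 0"
    and A0: "A0 = (\<lambda>t. - U t)"
    and B1: "B1 = (\<lambda>t. matrix_inv (A1 t) ** F2 t)"
    and B0: "B0 = (\<lambda>t. matrix_inv (A1 t) ** (F1 t - A0 t ** B1 t - mderiv A1 t ** B1 t))"
    and \<A>: "\<A> = diffop [A0, A1]"
    and \<B>: "\<B> = diffop [B0, B1]"
    and \<D>: "\<D> = \<A> \<circ> \<B>"
    and \<W>: "\<W> = (\<lambda>t. matrix_inv (A1 t) ** (F2 t ** W t) ** transpose (matrix_inv (A1 t)))"
    and \<P>: "\<P> = (\<lambda>n. \<A> (Pn n))"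
    and \<AA>: "\<AA> = left_span (- X) \<P>"
  shows "(\<forall>t\<in>I. invertible (mderiv P t) \<longrightarrow>
            matrix_inv (U t) ** matrix_inv (P t) ** mderiv P t = matrix_inv (A1 t))
       \<and> (\<forall>y. smooth_on I y \<longrightarrow> (\<forall>t\<in>I. invertible (mderiv P t) \<longrightarrow>
            \<A> y t = diffop [\<lambda>s. - U s, \<lambda>s. matrix_inv (mderiv P s) ** P s ** U s] y t))
       \<and> (\<forall>y. smooth_on I y \<longrightarrow> (\<forall>t\<in>I.
            \<B> y t = - ((formal_adjoint W [\<lambda>s. - (matrix_inv (P s) ** mderiv P s), \<lambda>s. mat 1]
                        \<circ> diffop [\<lambda>s. matrix_inv (A1 s) ** F2 s]) y t)))
       \<and> (\<forall>n\<in>- X. matrix_polynomial (\<P> n))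
       \<and> symmetric_wrt_pair I \<W> \<AA> \<D>
       \<and> orthogonal_family I \<W> (- X) \<P>
       \<and> (\<forall>n\<in>- X. \<forall>t\<in>I. \<D> (\<P> n) t = \<Gamma> n ** \<P> n t)"
proof -
  have poly: "matrix_polynomial (Pn n)" if "n \<in> - X" for n
    using Pn_poly that by (auto simp: matrix_polynomial_regular_def matrix_polynomial_def)
  interpret darboux_eigenfunctions a b I S W F0 F1 F2 P U A1 "- X" Pn \<Gamma>
    using assms poly by unfold_locales auto
  have inv: "matrix_inv (U t) ** matrix_inv (P t) ** mderiv P t = matrix_inv (A1 t)"
    if t: "t \<in> I" and P': "invertible (mderiv P t)" for t
  proof -
    have "A1 t = matrix_inv (mderiv P t) ** P t ** U t"
      using A1 t P' by blast
    moreover have "invertible (A1 t)"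
      using A1_zeros t I_subset_S by (auto simp: invertible_det_nz)
    \<comment> \<open>The nonzero determinant of \<open>A1 t\<close> has \<open>det (U t)\<close> as
      a factor. Once \<open>U t\<close> is invertible, a left inverse of the square matrix
      \<open>A1 t\<close> suffices.\<close>
    ultimately have "invertible (U t)"
      by (simp add: invertible_det_nz det_mul)
    then have "matrix_inv (U t) ** matrix_inv (P t) ** mderiv P t ** A1 t = mat 1"
      using A1 t P' P_invertible[OF t] by (simp add: matrix_mul_assoc matrix_inv_cancel)
    then show ?thesis
      by (rule matrix_inv_unique_left[symmetric])
  qed
  show ?thesis
    unfolding \<AA> \<P> \<D> \<W> \<A> \<B> A0 B0 B1
    using inv DB_formal_adjoint DA_polynomial[OF poly] DA_DB_symmetric DA_orthogonal DA_eigen A1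
    by (auto simp: diffop_order1)
qed

end
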